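(* Let $n\ge1$ and let $P$ be a complex polynomial of degree $n$ having all its zeros in $\{z\in\mathbb{C}:|z|\le k\}$, where $0<k\le1$ is real; that is, $P(z)=\alpha_n\prod_{j=1}^n(z-b_j)=\alpha_0+\alpha_1z+\dots+\alpha_nz^n$, $\alpha_n\ne0$, $|b_j|\le k\le1$ for $j=1,\dots,n$. Then for every $z\in\mathbb{C}$ with $|z|=1$, $$|P'(z)|\ge\frac{n}{k+1}\left\{1+\frac{k}{n}\left(\frac{k^n|\alpha_n|-|\alpha_0|}{k^n|\alpha_n|+|\alpha_0|}\right)\right\}|P(z)|.$$ *)

theory Defs
  imports Complex_Main "HOL-Computational_Algebra.Polynomial"
begin

end

theory Submission
  imports Defs "HOL-Computational_Algebra.Fundamental_Theorem_Algebra"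
begin

text \<open>
  On the unit circle \<open>P' / P\<close> is at least \<open>Re (z P'(z) / P(z)) = (\<Sum>j. Re (z / (z - b\<^sub>j)))\<close>
  in modulus, and each summand is at least \<open>1 / (1 + \<bar>b\<^sub>j\<bar>)\<close>. With \<open>t\<^sub>j = \<bar>b\<^sub>j\<bar> / k \<in> [0, 1]\<close>
  this is at least \<open>(1 + k (1 - t\<^sub>j) / (1 + t\<^sub>j)) / (k + 1)\<close>. The product of the \<open>t\<^sub>j\<close> is
  \<open>\<bar>\<alpha>\<^sub>0\<bar> / (k\<^sup>n \<bar>\<alpha>\<^sub>n\<bar>)\<close>, and \<open>t \<mapsto> (1 - t) / (1 + t)\<close> turns products in \<open>[0, 1]\<close> into at most sums.
\<close>

text \<open>With \<open>r = norm w\<close> and \<open>x = Re w\<close>, the right side is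
  \<open>(1 - x) / (1 - 2 * x + r\<^sup>2)\<close>. Cross-multiplying turns the claim into
  \<open>(1 - r) * (r + x) \<ge> 0\<close>.\<close>

lemma Re_inverse_one_minus_ge:
  fixes w :: complex
  assumes "norm w \<le> 1" "w \<noteq> 1"
  shows "1 / (1 + norm w) \<le> Re (1 / (1 - w))"
proof -
  define r x where "r = norm w" and "x = Re w"
  have r: "0 \<le> r" "r \<le> 1" and x: "\<bar>x\<bar> \<le> r"
    using assms abs_Re_le_cmod[of w] by (auto simp: r_def x_def)
  have sq: "(norm (1 - w))\<^sup>2 = 1 - 2 * x + r\<^sup>2"
    by (simp add: cmod_power2 r_def x_def power2_diff)
  have pos: "0 < 1 - 2 * x + r\<^sup>2"
    using assms(2) by (simp flip: sq)
  have "0 \<le> (1 - r) * (r + x)"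
    using r x by (intro mult_nonneg_nonneg) auto
  then have "1 - 2 * x + r\<^sup>2 \<le> (1 - x) * (1 + r)"
    by (simp add: algebra_simps power2_eq_square)
  then have "1 / (1 + r) \<le> (1 - x) / (1 - 2 * x + r\<^sup>2)"
    using r pos by (simp add: pos_divide_le_eq pos_le_divide_eq)
  also have "\<dots> = Re (1 / (1 - w))"
    unfolding sq[symmetric] by (simp add: Re_divide cmod_power2 x_def)
  finally show ?thesis by (simp add: r_def)
qed

text \<open>The right side combines to \<open>2 * (1 - a * b) / ((1 + a) * (1 + b))\<close>, so it
  suffices that \<open>(1 + a) * (1 + b) \<le> 2 * (1 + a * b)\<close>, which is
  \<open>(1 - a) * (1 - b) \<ge> 0\<close> rearranged.\<close>

lemma one_minus_over_one_plus_mult_le: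
  fixes a b :: real
  assumes "0 \<le> a" "a \<le> 1" "0 \<le> b" "b \<le> 1"
  shows "(1 - a * b) / (1 + a * b) \<le> (1 - a) / (1 + a) + (1 - b) / (1 + b)"
proof -
  have ab: "0 \<le> a * b" "a * b \<le> 1"
    using assms by (auto intro: mult_le_one)
  have "(1 + a) * (1 + b) \<le> 2 * (1 + a * b)"
    using mult_nonneg_nonneg[of "1 - a" "1 - b"] assms by (simp add: algebra_simps)
  then have "(1 - a * b) * ((1 + a) * (1 + b)) \<le> (1 - a * b) * (2 * (1 + a * b))"
    using ab by (intro mult_left_mono) auto
  then have "(1 - a * b) / (1 + a * b) \<le> 2 * (1 - a * b) / ((1 + a) * (1 + b))"
    using assms ab by (simp add: pos_divide_le_eq pos_le_divide_eq add_pos_nonneg) (simp add: algebra_simps)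
  also have "\<dots> = (1 - a) / (1 + a) + (1 - b) / (1 + b)"
    using assms by (simp add: add_frac_eq) (simp add: algebra_simps)
  finally show ?thesis .
qed

text \<open>Shrinking the inner denominator \<open>1 + t\<close> to \<open>1 + k * t\<close> makes
  the left side exactly \<open>1 / (1 + k * t)\<close>, because
  \<open>(1 + k * t) + k * (1 - t) = 1 + k\<close>.\<close>

lemma one_over_one_plus_mult_ge:
  fixes k t :: real
  assumes "0 < k" "k \<le> 1" "0 \<le> t" "t \<le> 1"
  shows "(1 + k * ((1 - t) / (1 + t))) / (k + 1) \<le> 1 / (1 + k * t)"
proof -
  have kt: "0 \<le> k * t" "k * t \<le> t"
    using assms by (auto intro: mult_left_le_one_le)
  have "k * ((1 - t) / (1 + t)) \<le> k * ((1 - t) / (1 + k * t))"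
    using assms kt by (intro mult_left_mono divide_left_mono) auto
  then have "(1 + k * ((1 - t) / (1 + t))) / (k + 1) \<le> (1 + k * ((1 - t) / (1 + k * t))) / (k + 1)"
    using assms by (intro divide_right_mono) auto
  also have "\<dots> = ((1 + k) / (1 + k * t)) / (k + 1)"
    using kt by (simp add: divide_simps algebra_simps)
  also have "\<dots> = 1 / (1 + k * t)"
    using assms by (simp add: add.commute[of k])
  finally show ?thesis .
qed

text \<open>Induction on the degree, splitting off one root at a time. By Vieta, \<open>T P\<close>
  is the product of the moduli of the roots divided by \<open>k\<close>. The bound
  \<open>T P \<le> 1\<close> is carried along because the product inequality needs both of its
  arguments in [0, 1].\<close>

lemma Re_logarithmic_derivative_ge:
  fixes P :: "complex poly" and k :: real and z :: complex
  defines "T \<equiv> \<lambda>P. norm (coeff P 0) / (k ^ degree P * norm (lead_coeff P))"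
  assumes k: "0 < k" "k \<le> 1" and z: "norm z = 1"
    and "poly P z \<noteq> 0" "\<And>w. poly P w = 0 \<Longrightarrow> norm w \<le> k"
  shows "T P \<le> 1 \<and> (real (degree P) + k * ((1 - T P) / (1 + T P))) / (k + 1)
           \<le> Re (z * poly (pderiv P) z / poly P z)"
  using assms(5,6)
proof (induction "degree P" arbitrary: P)
  \<comment> \<open>A nonzero constant has \<open>T P = 1\<close>, the empty product, so both sides
    of the inequality are 0.\<close>
  case 0
  then obtain c where "P = [:c:]"
    by (metis degree_eq_zeroE)
  with 0 show ?case
    by (simp add: T_def)
next
  case (Suc m)
  then obtain b where "poly P b = 0"
    using fundamental_theorem_of_algebra[of P] by (auto simp: constant_degree)
  then obtain Q where P: "P = [:- b, 1:] * Q"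
    by (auto simp: poly_eq_0_iff_dvd)
  have Q: "poly Q z \<noteq> 0" "\<And>w. poly Q w = 0 \<Longrightarrow> norm w \<le> k"
    and zb: "z \<noteq> b" and b: "norm b \<le> k"
    using Suc.prems by (auto simp: P)
  then have "Q \<noteq> 0"
    by auto
  then have deg: "degree P = Suc (degree Q)"
    unfolding P by (subst degree_mult_eq) auto
  define s t where "s = T Q" and "t = norm b / k"
  have IH: "s \<le> 1" "(real (degree Q) + k * ((1 - s) / (1 + s))) / (k + 1)
      \<le> Re (z * poly (pderiv Q) z / poly Q z)"
    using Suc.hyps(1)[OF _ Q] Suc.hyps(2) deg by (auto simp: s_def)
  have s: "0 \<le> s"
    using k by (simp add: s_def T_def)
  have t: "0 \<le> t" "t \<le> 1" and bt: "norm b = k * t"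
    using k b by (auto simp: t_def)
  have lc: "lead_coeff P = lead_coeff Q"
    unfolding P by (simp only: lead_coeff_mult) simp
  have c0: "coeff P 0 = - b * coeff Q 0"
    by (simp add: P)
  have TP: "T P = t * s"
    \<comment> \<open>The new root contributes \<open>norm b\<close> to the constant coefficient and
      one more power of \<open>k\<close> to the denominator, while the leading coefficient is
      unchanged.\<close>
    using k unfolding T_def lc c0 unfolding s_def t_def T_def deg by (simp add: norm_mult)
  have "z \<noteq> 0"
    using z by auto
  \<comment> \<open>Since z lies on the unit circle, \<open>w = b / z\<close> has the modulus of b,
    and \<open>z / (z - b)\<close> takes the form \<open>1 / (1 - w)\<close>.\<close>
  then have "norm (b / z) = k * t" "b / z \<noteq> 1" "1 / (1 - b / z) = z / (z - b)"
    using z zb bt by (auto simp: norm_divide field_simps)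
  then have "1 / (1 + k * t) \<le> Re (z / (z - b))"
    using Re_inverse_one_minus_ge[of "b / z"] b k bt by auto
  then have step: "(1 + k * ((1 - t) / (1 + t))) / (k + 1) \<le> Re (z / (z - b))"
    using one_over_one_plus_mult_ge[OF k t] by linarith
  have "(real (degree P) + k * ((1 - T P) / (1 + T P))) / (k + 1)
      \<le> (real (degree P) + k * ((1 - t) / (1 + t) + (1 - s) / (1 + s))) / (k + 1)"
    unfolding TP using k one_minus_over_one_plus_mult_le[OF t s IH(1)]
    by (intro divide_right_mono add_left_mono mult_left_mono) auto
  also have "\<dots> = (1 + k * ((1 - t) / (1 + t))) / (k + 1)
      + (real (degree Q) + k * ((1 - s) / (1 + s))) / (k + 1)"
    unfolding deg add_divide_distrib[symmetric] by (simp add: algebra_simps)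
  also have "\<dots> \<le> Re (z / (z - b)) + Re (z * poly (pderiv Q) z / poly Q z)"
    using step IH(2) by (rule add_mono)
  also have "\<dots> = Re (z / (z - b) + z * poly (pderiv Q) z / poly Q z)"
    by simp
  also have "z / (z - b) + z * poly (pderiv Q) z / poly Q z = z * poly (pderiv P) z / poly P z"
    using Q(1) zb unfolding P pderiv_mult by (simp add: pderiv_pCons field_simps)
  finally show ?case
    using t s IH(1) by (simp add: TP mult_le_one)
qed

theorem corollary10:
  fixes P :: "complex poly" and n :: nat and k :: real and z :: complex
  assumes "n \<ge> 1"
    and "degree P = n"
    and "0 < k" and "k \<le> 1"
    and "\<And>w. poly P w = 0 \<Longrightarrow> norm w \<le> k"
    and "norm z = 1"
  shows "norm (poly (pderiv P) z) \<ge>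
    real n / (k + 1) *
      (1 + k / real n *
        ((k ^ n * norm (coeff P n) - norm (coeff P 0)) /
         (k ^ n * norm (coeff P n) + norm (coeff P 0)))) *
    norm (poly P z)"
proof (cases "poly P z = 0")
  case True
  then show ?thesis by simp
next
  case False
  define A where "A = k ^ n * norm (coeff P n)"
  define B where "B = norm (coeff P 0)"
  have "coeff P n \<noteq> 0"
    using False assms(2) by auto
  then have A: "0 < A"
    using assms(3) by (simp add: A_def)
  have B: "0 \<le> B"
    by (simp add: B_def)
  \<comment> \<open>\<open>B / A\<close> is the quantity \<open>T P\<close> of the preceding lemma;
    clearing the inner fraction gives the quotient in the goal.\<close>
  have AB: "(1 - B / A) / (1 + B / A) = (A - B) / (A + B)"
    using A B by (simp add: divide_simps)
  have "real n / (k + 1) * (1 + k / real n * x) = (real n + k * x) / (k + 1)" for x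
    using assms(1) by (simp add: distrib_left flip: add_divide_distrib)
  then have "real n / (k + 1) * (1 + k / real n * ((A - B) / (A + B)))
      = (real n + k * ((A - B) / (A + B))) / (k + 1)" .
  also have "\<dots> \<le> Re (z * poly (pderiv P) z / poly P z)"
    using Re_logarithmic_derivative_ge[OF assms(3,4,6) False assms(5)]
    unfolding assms(2) A_def[symmetric] B_def[symmetric] AB by blast
  also have "\<dots> \<le> norm (z * poly (pderiv P) z / poly P z)"
    by (rule complex_Re_le_cmod)
  also have "\<dots> = norm (poly (pderiv P) z) / norm (poly P z)"
    by (simp add: norm_mult norm_divide assms(6))
  finally show ?thesis
    using False by (simp add: A_def B_def pos_le_divide_eq)
qed

end
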